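(* Let $n\ge1$, let $\varphi:[0,\infty)\to[0,\infty)$ be a measurable function, and let $(Z_1,\dots,Z_n)\in\mathbb{C}^n$ be a random vector with probability density function $$f(z_1,\dots,z_n)=C\cdot\prod_{1\le j<k\le n}|z_j-z_k|^2\cdot\prod_{j=1}^n\varphi(|z_j|)$$ with respect to Lebesgue measure on $\mathbb{C}^n$. Set $c_k=2\pi\int_0^\infty x^{2k+1}\varphi(x)\,dx$ for $k=0,\dots,n-1$. Then $C^{-1}=n!\,c_0c_1\cdots c_{n-1}$, and $(Z_1,\dots,Z_n)$ forms a determinantal point process with background measure $\varphi(|z|)\,dz$ and kernel $$K(z,w)=\sum_{k=0}^{n-1}\frac{1}{c_k}(z\bar w)^k.$$
   Context: Standing assumption: $0<\int_0^\infty y^{2j-1}\varphi(y)\,dy<\infty$ for each $1\le j\le n$. $dz$ denotes Lebesgue measure on $\mathbb{C}\cong\mathbb{R}^2$. Definition: let $K:\mathbb{C}^2\to\mathbb{C}$ satisfy $\overline{K(z,w)}=K(w,z)$, and let $\nu$ be a Borel measure on $\mathbb{C}$. The complex random variables $\{Z_1,\dots,Z_n\}$ form a determinantal point process with kernel $K$ and background measure $\nu$ if for every $1\le k\le n$ the density of $(Z_1,\dots,Z_k)$ with respect to $\nu^{\otimes k}$ is $\frac{(n-k)!}{n!}\det\big(K(z_j,z_l)\big)_{1\le j,l\le k}$. *)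

theory Defs
  imports "HOL-Probability.Probability" "Jordan_Normal_Form.Determinant"
begin

text \<open>
  Random vectors with $n$ complex entries are families \<open>Z :: nat \<Rightarrow> 'a \<Rightarrow> complex\<close> of which only the
  indices \<open>0, \<dots>, n - 1\<close> matter, so \<open>Z i\<close> is the usual $Z_{i+1}$. The joint law of
  the first \<open>k\<close> of them lives on the extensional functions on \<open>{..<k}\<close>.
\<close>

definition first_vars :: "nat \<Rightarrow> (nat \<Rightarrow> 'a \<Rightarrow> complex) \<Rightarrow> 'a \<Rightarrow> nat \<Rightarrow> complex" where
  "first_vars k Z = (\<lambda>\<omega>. \<lambda>i\<in>{..<k}. Z i \<omega>)"

definition kernel_det ::
  "(complex \<Rightarrow> complex \<Rightarrow> complex) \<Rightarrow> nat \<Rightarrow> (nat \<Rightarrow> complex) \<Rightarrow> complex" where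
  "kernel_det K k z = Determinant.det (Matrix.mat k k (\<lambda>(j, l). K (z j) (z l)))"

text \<open>
  The determinants are complex numbers, while \<^const>\<open>distributed\<close> wants a density in
  \<^typ>\<open>ennreal\<close>. The almost-everywhere conjunct makes sure that passing through \<^const>\<open>Re\<close> and
  \<^const>\<open>ennreal\<close> does not discard an imaginary or a negative part.
  The product \<open>\<Pi>\<^sub>M\<close> is the usual product measure only for \<open>\<sigma>\<close>-finite \<open>\<nu>\<close>; this holds for every
  \<open>\<nu>\<close> that has a real-valued density with respect to Lebesgue measure.
\<close>

definition determinantal_point_process ::
  "'a measure \<Rightarrow> nat \<Rightarrow> (nat \<Rightarrow> 'a \<Rightarrow> complex) \<Rightarrow> (complex \<Rightarrow> complex \<Rightarrow> complex) \<Rightarrow>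
    complex measure \<Rightarrow> bool" where
  "determinantal_point_process M n Z K \<nu> \<longleftrightarrow>
     sets \<nu> = sets borel \<and>
     (\<forall>z w. cnj (K z w) = K w z) \<and>
     (\<forall>k. 1 \<le> k \<and> k \<le> n \<longrightarrow>
        (AE z in \<Pi>\<^sub>M i\<in>{..<k}. \<nu>. kernel_det K k z \<in> \<real>\<^sub>\<ge>\<^sub>0) \<and>
        distributed M (\<Pi>\<^sub>M i\<in>{..<k}. \<nu>) (first_vars k Z)
          (\<lambda>z. ennreal (fact (n - k) / fact n * Re (kernel_det K k z))))"

end

theory Submission
  imports Defs
begin

text \<open>
  By rotation invariance the monomials $z^k$ are orthogonal for the measure
  $\nu = \varphi(|z|)\,dz$, with squared norms $c_k$, so $K$ is the kernel of the orthogonal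
  projection onto their span in $L^2(\nu)$. The Vandermonde determinant turns the density of
  $(Z_1, \dots, Z_n)$ with respect to $\nu^{\otimes n}$ into a constant multiple of
  $\det (K(z_j, z_l))$. Integrating out one point after the other, each step replaces the
  $(k+1)$-point determinant by $n - k$ times the $k$-point determinant; this gives all
  marginals, their nonnegativity, and the normalising constant.
\<close>

subsection \<open>Lebesgue measure on the complex plane\<close>

text \<open>The factor n - k is a trace minus a count of rows: when a determinant is bordered by a
  new point x, the corner K x x integrates to n, the rank of the projection, and each of the k old
  rows costs one copy of the old determinant. Only the n-point determinant is visibly nonnegative,
  since only there the Vandermonde factors are square. The smaller ones inherit nonnegativity
  downwards from n through integrals of complex functions. This has to precede any integration of
  determinants in \<open>ennreal\<close>, which would discard signs and imaginary parts.\<close>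

lemma lborel_complex_eq:
  "(lborel :: complex measure) = distr (lborel \<Otimes>\<^sub>M lborel) borel (\<lambda>(x, y). Complex x y)"
proof (rule lborel_eqI)
  have [measurable]: "(\<lambda>(x, y). Complex x y) \<in> borel_measurable (borel \<Otimes>\<^sub>M borel)"
    unfolding Complex_eq by measurable
  fix l u :: complex
  assume "\<And>b. b \<in> Basis \<Longrightarrow> l \<bullet> b \<le> u \<bullet> b"
  then have le: "Re l \<le> Re u" "Im l \<le> Im u"
    by (force simp: Basis_complex_def)+
  have "emeasure (distr (lborel \<Otimes>\<^sub>M lborel) borel (\<lambda>(x, y). Complex x y)) (box l u) =
      emeasure (lborel \<Otimes>\<^sub>M lborel) ({Re l<..<Re u} \<times> {Im l<..<Im u})"
    by (subst emeasure_distr)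
       (auto intro!: arg_cong2[where f=emeasure] simp: box_def Basis_complex_def space_pair_measure)
  also have "\<dots> = (\<Prod>b\<in>Basis. (u - l) \<bullet> b)"
    using le by (subst lborel.emeasure_pair_measure_Times) (auto simp: Basis_complex_def ennreal_mult)
  finally show "emeasure (distr (lborel \<Otimes>\<^sub>M lborel) borel (\<lambda>(x, y). Complex x y)) (box l u) =
      (\<Prod>b\<in>Basis. (u - l) \<bullet> b)" .
qed simp

text \<open>Both orders are recorded because a shear is a translation in one coordinate only, and
  that coordinate has to be the inner variable.\<close>

lemma nn_integral_lborel_complex:
  fixes f :: "complex \<Rightarrow> ennreal"
  assumes [measurable]: "f \<in> borel_measurable borel"
  shows "(\<integral>\<^sup>+z. f z \<partial>lborel) = (\<integral>\<^sup>+x. \<integral>\<^sup>+y. f (Complex x y) \<partial>lborel \<partial>lborel)"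
    and "(\<integral>\<^sup>+z. f z \<partial>lborel) = (\<integral>\<^sup>+y. \<integral>\<^sup>+x. f (Complex x y) \<partial>lborel \<partial>lborel)"
proof -
  have [measurable]: "(\<lambda>(x, y). Complex x y) \<in> borel_measurable (borel \<Otimes>\<^sub>M borel)"
    unfolding Complex_eq by measurable
  show *: "(\<integral>\<^sup>+z. f z \<partial>lborel) = (\<integral>\<^sup>+x. \<integral>\<^sup>+y. f (Complex x y) \<partial>lborel \<partial>lborel)"
    by (subst lborel_complex_eq, subst nn_integral_distr)
       (simp_all add: split_beta' lborel.nn_integral_fst[symmetric])
  show "(\<integral>\<^sup>+z. f z \<partial>lborel) = (\<integral>\<^sup>+y. \<integral>\<^sup>+x. f (Complex x y) \<partial>lborel \<partial>lborel)"
    unfolding * by (rule lborel_pair.Fubini') measurable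
qed

lemma nn_integral_lborel_translate:
  fixes f :: "real \<Rightarrow> ennreal"
  assumes "f \<in> borel_measurable borel"
  shows "(\<integral>\<^sup>+x. f (x + t) \<partial>lborel) = (\<integral>\<^sup>+x. f x \<partial>lborel)"
  using nn_integral_real_affine[OF assms, of 1 t] by (simp add: add.commute)

text \<open>With the imaginary part y frozen, the map translates x by t * y, which the inner
  integral does not see.\<close>

lemma nn_integral_lborel_shear_Re:
  fixes f :: "complex \<Rightarrow> ennreal"
  assumes [measurable]: "f \<in> borel_measurable borel"
  shows "(\<integral>\<^sup>+z. f (Complex (Re z + t * Im z) (Im z)) \<partial>lborel) = (\<integral>\<^sup>+z. f z \<partial>lborel)"
proof -
  have [measurable]: "(\<lambda>x. Complex x y) \<in> borel_measurable borel" for y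
    unfolding Complex_eq by measurable
  have "(\<lambda>z. f (Complex (Re z + t * Im z) (Im z))) \<in> borel_measurable borel"
    unfolding Complex_eq by measurable
  then show ?thesis
    by (simp add: nn_integral_lborel_complex(2)
        nn_integral_lborel_translate[where f="\<lambda>x. f (Complex x y)" for y])
qed

lemma nn_integral_lborel_shear_Im:
  fixes f :: "complex \<Rightarrow> ennreal"
  assumes [measurable]: "f \<in> borel_measurable borel"
  shows "(\<integral>\<^sup>+z. f (Complex (Re z) (Im z + t * Re z)) \<partial>lborel) = (\<integral>\<^sup>+z. f z \<partial>lborel)"
proof -
  have [measurable]: "(\<lambda>y. Complex x y) \<in> borel_measurable borel" for x
    unfolding Complex_eq by measurable
  have "(\<lambda>z. f (Complex (Re z) (Im z + t * Re z))) \<in> borel_measurable borel"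
    unfolding Complex_eq by measurable
  then show ?thesis
    by (simp add: nn_integral_lborel_complex(1)
        nn_integral_lborel_translate[where f="\<lambda>y. f (Complex x y)" for x])
qed

text \<open>A rotation by an angle that is not a multiple of \<open>\<pi>\<close> is a product of three shears.\<close>

lemma nn_integral_lborel_rotate:
  fixes f :: "complex \<Rightarrow> ennreal"
  assumes f [measurable]: "f \<in> borel_measurable borel" and u: "cmod u = 1" "Im u \<noteq> 0"
  shows "(\<integral>\<^sup>+z. f (u * z) \<partial>lborel) = (\<integral>\<^sup>+z. f z \<partial>lborel)"
proof -
  \<comment> \<open>For u = cis s one has t = (cos s - 1) / sin s = - tan (s / 2), the parameter of
    the outer two shears in the classical three-shear form of a rotation; the middle one has
    parameter sin s.\<close>
  define a b t where "a = Re u" and "b = Im u" and "t = (a - 1) / b"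
  have ab: "b \<noteq> 0" "a\<^sup>2 + b\<^sup>2 = 1"
    using u cmod_power2[of u] by (auto simp: a_def b_def)
  have a: "a = 1 + t * b"
    using ab by (simp add: t_def)
  \<comment> \<open>In the real part of the composite, Im z gets the coefficient t * (2 + t * b) = t
    * (a + 1), which has to be - b.\<close>
  have "t * (a + 1) = (a\<^sup>2 - 1) / b"
    by (simp add: t_def power2_eq_square field_simps)
  also have "\<dots> = - b"
    using ab by (simp add: field_simps power2_eq_square)
  finally have b: "t * (a + 1) = - b" .
  define P where "P z = Complex (Re z + t * Im z) (Im z)" for z
  define Q where "Q z = Complex (Re z) (Im z + b * Re z)" for z
  have [measurable]: "P \<in> borel_measurable borel" "Q \<in> borel_measurable borel"
    unfolding P_def Q_def Complex_eq by measurable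
  have fP: "(\<lambda>z. f (P z)) \<in> borel_measurable borel"
    and fPQ: "(\<lambda>z. f (P (Q z))) \<in> borel_measurable borel"
    by measurable
  have "u * z = P (Q (P z))" for z
  proof (rule complex_eqI)
    have "Re (P (Q (P z))) = (1 + t * b) * Re z + t * ((1 + t * b) + 1) * Im z"
      by (simp add: P_def Q_def algebra_simps)
    then show "Re (u * z) = Re (P (Q (P z)))"
      using b by (simp add: a[symmetric]) (simp add: a_def b_def)
    have "Im (P (Q (P z))) = b * Re z + (1 + t * b) * Im z"
      by (simp add: P_def Q_def algebra_simps)
    then show "Im (u * z) = Im (P (Q (P z)))"
      by (simp add: a[symmetric]) (simp add: a_def b_def)
  qed
  moreover have "(\<integral>\<^sup>+z. f (P (Q (P z))) \<partial>lborel) = (\<integral>\<^sup>+z. f (P (Q z)) \<partial>lborel)"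
    using nn_integral_lborel_shear_Re[OF fPQ, of t] by (simp flip: P_def)
  moreover have "\<dots> = (\<integral>\<^sup>+z. f (P z) \<partial>lborel)"
    using nn_integral_lborel_shear_Im[OF fP, of b] by (simp flip: Q_def)
  moreover have "\<dots> = (\<integral>\<^sup>+z. f z \<partial>lborel)"
    using nn_integral_lborel_shear_Re[OF f, of t] by (simp flip: P_def)
  ultimately show ?thesis by simp
qed

lemma distr_lborel_rotate:
  assumes "cmod u = 1" "Im u \<noteq> 0"
  shows "distr lborel borel (\<lambda>z. u * z) = (lborel :: complex measure)"
proof (rule measure_eqI)
  fix A :: "complex set" assume "A \<in> sets (distr lborel borel (\<lambda>z. u * z))"
  then have A [measurable]: "A \<in> sets borel" by simp
  have "emeasure (distr lborel borel (\<lambda>z. u * z)) A =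
      (\<integral>\<^sup>+z. indicator A z \<partial>distr lborel borel (\<lambda>z. u * z))"
    by simp
  also have "\<dots> = (\<integral>\<^sup>+z. indicator A (u * z) \<partial>lborel)"
    by (rule nn_integral_distr) auto
  also have "\<dots> = emeasure lborel A"
    by (subst nn_integral_lborel_rotate[OF _ assms]) auto
  finally show "emeasure (distr lborel borel (\<lambda>z. u * z)) A = emeasure lborel A" .
qed simp

text \<open>Polar coordinates for radial functions, without a change of variables: both sides give
  \<open>{..r}\<close> the area pi * r^2 of a disc if r \<ge> 0 and mass 0 otherwise, and these
  half-lines form an intersection-stable generator.\<close>

lemma distr_lborel_cmod:
  "distr lborel borel cmod = density lborel (\<lambda>x. ennreal (2 * pi * x) * indicator {0..} x)"
    (is "?D = ?E")
proof (rule measure_eqI_generator_eq[where E="range atMost" and \<Omega>=UNIV and A="\<lambda>i. {..real i}"])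
  have D: "emeasure ?D {..r} = ennreal (pi * r\<^sup>2)" if "r \<ge> 0" for r
  proof -
    have "emeasure ?D {..r} = emeasure lborel (cball (0::complex) r)"
      by (subst emeasure_distr) (auto intro!: arg_cong2[where f=emeasure])
    then show ?thesis
      using that by (simp add: emeasure_cball unit_ball_vol_2)
  qed
  fix X :: "real set" assume "X \<in> range atMost"
  then obtain r where X: "X = {..r}" by auto
  show "emeasure ?D X = emeasure ?E X"
  proof (cases "r \<ge> 0")
    case True
    have "emeasure ?E {..r} = (\<integral>\<^sup>+x. ennreal (2 * pi * x) * indicator {0..r} x \<partial>lborel)"
      by (subst emeasure_density) (auto intro!: nn_integral_cong split: split_indicator)
    also have "\<dots> = ennreal (pi * r\<^sup>2 - pi * 0\<^sup>2)"
      using True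
      by (intro nn_integral_FTC_Icc) (auto intro!: derivative_eq_intros)
    finally show ?thesis using D[OF True] by (simp add: X)
  next
    case False
    have "emeasure ?E {..r} = (\<integral>\<^sup>+x. 0 \<partial>(lborel::real measure))"
      using False by (subst emeasure_density) (auto intro!: nn_integral_cong simp del: nn_integral_const split: split_indicator)
    moreover have "cmod -` {..r} = {}"
      using False order_trans[OF norm_ge_zero] by auto
    then have "emeasure ?D {..r} = 0"
      by (subst emeasure_distr) auto
    ultimately show ?thesis by (simp add: X)
  qed
next
  fix i
  have "emeasure ?D {..real i} = emeasure lborel (cball (0::complex) (real i))"
    by (subst emeasure_distr) (auto intro!: arg_cong2[where f=emeasure])
  then show "emeasure ?D {..real i} \<noteq> \<infinity>"
    by (simp add: emeasure_cball)
next
  show "Int_stable (range (atMost :: real \<Rightarrow> _))"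
    by (auto simp: Int_stable_def)
  show "(\<Union>i. {..real i}) = UNIV"
    using real_arch_simple by auto
qed (auto simp: borel_eq_atMost)

lemma nn_integral_radial:
  fixes g :: "real \<Rightarrow> ennreal"
  assumes [measurable]: "g \<in> borel_measurable borel"
  shows "(\<integral>\<^sup>+z. g (cmod z) \<partial>lborel) = (\<integral>\<^sup>+x\<in>{0..}. ennreal (2 * pi * x) * g x \<partial>lborel)"
proof -
  have "(\<integral>\<^sup>+z. g (cmod z) \<partial>lborel) = (\<integral>\<^sup>+x. g x \<partial>distr lborel borel cmod)"
    by (rule nn_integral_distr[symmetric]) auto
  then show ?thesis
    by (simp add: distr_lborel_cmod nn_integral_density ac_simps)
qed

subsection \<open>Determinants\<close>

text \<open>Expansion along the last column and then along the last row of each minor.\<close>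

lemma det_bordered:
  fixes A :: "'a :: comm_ring_1 mat"
  assumes A: "A \<in> carrier_mat (Suc k) (Suc k)"
  shows "Determinant.det A = A $$ (k, k) * Determinant.det (mat_delete A k k) -
    (\<Sum>i<k. \<Sum>l<k. A $$ (i, k) * A $$ (k, l) * cofactor (mat_delete A k k) i l)"
proof -
  have minor: "A $$ (i, k) * cofactor A i k =
      - (\<Sum>l<k. A $$ (i, k) * A $$ (k, l) * cofactor (mat_delete A k k) i l)"
    if i: "i < k" for i
  proof -
    define D where "D = mat_delete A i k"
    have D: "D \<in> carrier_mat k k"
      using mat_delete_carrier[OF A] by (simp add: D_def)
    \<comment> \<open>The deleted row lies above the last one, so row k of A sits at index k - 1 of
      D. This shift makes the two exponents in \<open>sign\<close> add up to i + l + (2 * k - 1),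
      the source of the minus sign.\<close>
    have row: "D $$ (k - 1, l) = A $$ (k, l)" if "l < k" for l
      using i that A by (auto simp: D_def mat_delete_def)
    have del: "mat_delete D (k - 1) l = mat_delete (mat_delete A k k) i l" if "l < k" for l
      using i that A by (intro eq_matI) (auto simp: D_def mat_delete_def)
    have sign: "(- 1) ^ (i + k) * (- 1) ^ (k - 1 + l) = - ((- 1) ^ (i + l) :: 'a)" for l
    proof -
      obtain m where m: "k = Suc m"
        using i by (cases k) auto
      have "(- 1) ^ (i + k) * (- 1) ^ (k - 1 + l) = - ((- 1) ^ (i + l) * ((- 1) ^ m * (- 1) ^ m) :: 'a)"
        by (simp add: m power_add mult_ac)
      then show ?thesis
        by (simp add: power_mult_distrib[symmetric])
    qed
    have "cofactor A i k = (- 1) ^ (i + k) * Determinant.det D"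
      by (simp add: cofactor_def D_def)
    also have "Determinant.det D = (\<Sum>l<k. D $$ (k - 1, l) * cofactor D (k - 1) l)"
      using i by (intro laplace_expansion_row[OF D]) auto
    also have "\<dots> = (\<Sum>l<k. A $$ (k, l) *
        ((- 1) ^ (k - 1 + l) * Determinant.det (mat_delete (mat_delete A k k) i l)))"
      by (intro sum.cong refl) (simp only: row del cofactor_def lessThan_iff)
    also have "(- 1) ^ (i + k) * \<dots> = (\<Sum>l<k. A $$ (k, l) *
        ((- 1) ^ (i + k) * (- 1) ^ (k - 1 + l) * Determinant.det (mat_delete (mat_delete A k k) i l)))"
      by (simp add: sum_distrib_left mult_ac)
    also have "\<dots> = - (\<Sum>l<k. A $$ (k, l) * cofactor (mat_delete A k k) i l)"
      unfolding sign by (simp add: sum_negf cofactor_def mult_ac)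
    finally show ?thesis
      by (simp add: sum_distrib_left mult_ac)
  qed
  have "Determinant.det A = (\<Sum>i<Suc k. A $$ (i, k) * cofactor A i k)"
    by (rule laplace_expansion_column[OF A]) auto
  also have "\<dots> = (\<Sum>i<k. A $$ (i, k) * cofactor A i k) + A $$ (k, k) * cofactor A k k"
    by simp
  also have "cofactor A k k = Determinant.det (mat_delete A k k)"
    by (simp add: cofactor_def)
  finally show ?thesis
    using minor by (simp add: sum_negf)
qed

definition newton_poly :: "(nat \<Rightarrow> 'a :: idom) \<Rightarrow> nat \<Rightarrow> 'a poly" where
  "newton_poly z k = (\<Prod>i<k. [:- z i, 1:])"

lemma degree_newton_poly: "degree (newton_poly z k) = k"
  unfolding newton_poly_def by (subst degree_prod_eq_sum_degree) auto

lemma coeff_newton_poly: "coeff (newton_poly z k) k = 1"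
proof -
  have "lead_coeff (newton_poly z k) = 1"
    unfolding newton_poly_def lead_coeff_prod by simp
  then show ?thesis
    by (simp add: degree_newton_poly)
qed

text \<open>Changing from the monomial basis to the Newton basis is unitriangular and makes the
  Vandermonde matrix lower triangular.\<close>

lemma det_vandermonde:
  fixes z :: "nat \<Rightarrow> 'a :: idom"
  shows "Determinant.det (Matrix.mat n n (\<lambda>(j, k). z j ^ k)) = (\<Prod>k<n. \<Prod>j<k. z k - z j)"
proof -
  define V where "V = Matrix.mat n n (\<lambda>(j, k). z j ^ k)"
  define U where "U = Matrix.mat n n (\<lambda>(i, k). coeff (newton_poly z k) i)"
  have carrier: "V \<in> carrier_mat n n" "U \<in> carrier_mat n n" "V * U \<in> carrier_mat n n"
    by (auto simp: V_def U_def)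
  have entry: "(V * U) $$ (j, k) = (\<Prod>i<k. z j - z i)" if "j < n" "k < n" for j k
  proof -
    have "(V * U) $$ (j, k) = (\<Sum>i<n. coeff (newton_poly z k) i * z j ^ i)"
      using that by (simp add: V_def U_def scalar_prod_def atLeast0LessThan mult.commute)
    also have "\<dots> = (\<Sum>i\<le>k. coeff (newton_poly z k) i * z j ^ i)"
      using that by (intro sum.mono_neutral_right) (auto intro!: coeff_eq_0 simp: degree_newton_poly)
    also have "\<dots> = poly (newton_poly z k) (z j)"
      by (simp add: poly_altdef degree_newton_poly)
    also have "\<dots> = (\<Prod>i<k. z j - z i)"
      by (simp add: newton_poly_def poly_prod)
    finally show ?thesis .
  qed
  \<comment> \<open>For j < k the entry contains the factor with i = j, which is zero, so the
    product is lower triangular.\<close>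
  have "Determinant.det (V * U) = (\<Prod>k<n. (V * U) $$ (k, k))"
    using carrier(3)
    by (subst det_lower_triangular[OF _ carrier(3)])
       (auto simp: entry prod_list_diag_prod atLeast0LessThan intro!: prod_zero)
  also have "\<dots> = (\<Prod>k<n. \<Prod>j<k. z k - z j)"
    by (simp add: entry)
  finally have VU: "Determinant.det (V * U) = (\<Prod>k<n. \<Prod>j<k. z k - z j)" .
  have "upper_triangular U"
    unfolding upper_triangular_def by (auto simp: U_def intro!: coeff_eq_0 simp: degree_newton_poly)
  then have "Determinant.det U = (\<Prod>k<n. U $$ (k, k))"
    using carrier(2) by (simp add: det_upper_triangular prod_list_diag_prod atLeast0LessThan)
  then have "Determinant.det U = 1"
    by (simp add: U_def coeff_newton_poly)
  then show ?thesis
    using VU det_mult[OF carrier(1,2)] by (simp add: V_def)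
qed

text \<open>The matrix of kernel values is V times D times the transpose of W, where V is the
  Vandermonde matrix of the points, W its conjugate and D the diagonal matrix of the 1 / c k. All
  factors are square because there are as many points as monomials, so the determinant is the
  squared modulus of det V divided by the product of the c k.\<close>

lemma kernel_det_projection:
  assumes "\<And>k. k < n \<Longrightarrow> c k \<noteq> 0"
  shows "kernel_det (\<lambda>z w. \<Sum>k<n. 1 / complex_of_real (c k) * (z * cnj w) ^ k) n z =
    of_real ((\<Prod>k<n. \<Prod>j<k. (cmod (z j - z k))\<^sup>2) / (\<Prod>k<n. c k))"
proof -
  define V where "V u = Matrix.mat n n (\<lambda>(j, k). u j ^ k)" for u :: "nat \<Rightarrow> complex"
  define D where "D = Matrix.mat n n (\<lambda>(j, k). if j = k then 1 / complex_of_real (c k) else 0)"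
  define W where "W = V (\<lambda>j. cnj (z j))"
  have carrier: "V u \<in> carrier_mat n n" "D \<in> carrier_mat n n" "W\<^sup>T \<in> carrier_mat n n" "W \<in> carrier_mat n n" for u
    by (auto simp: V_def D_def W_def)
  have DW: "D * W\<^sup>T = Matrix.mat n n (\<lambda>(k, j). 1 / complex_of_real (c k) * cnj (z j) ^ k)"
  proof (rule eq_matI)
    fix k j assume "k < dim_row (Matrix.mat n n (\<lambda>(k, j). 1 / complex_of_real (c k) * cnj (z j) ^ k))"
      and "j < dim_col (Matrix.mat n n (\<lambda>(k, j). 1 / complex_of_real (c k) * cnj (z j) ^ k))"
    then have kj: "k < n" "j < n" by auto
    then have "(D * W\<^sup>T) $$ (k, j) =
        (\<Sum>i<n. (if k = i then 1 / complex_of_real (c i) else 0) * cnj (z j) ^ i)"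
      by (simp add: D_def W_def V_def scalar_prod_def atLeast0LessThan)
    also have "\<dots> = (\<Sum>i<n. if k = i then 1 / complex_of_real (c i) * cnj (z j) ^ i else 0)"
      by (intro sum.cong) auto
    also have "\<dots> = 1 / complex_of_real (c k) * cnj (z j) ^ k"
      using kj by simp
    finally show "(D * W\<^sup>T) $$ (k, j) =
        Matrix.mat n n (\<lambda>(k, j). 1 / complex_of_real (c k) * cnj (z j) ^ k) $$ (k, j)"
      using kj by simp
  qed (auto simp: D_def W_def V_def)
  have "Matrix.mat n n (\<lambda>(j, l). \<Sum>k<n. 1 / complex_of_real (c k) * (z j * cnj (z l)) ^ k) =
      V z * (D * W\<^sup>T)"
    by (rule eq_matI)
       (auto simp: DW V_def scalar_prod_def atLeast0LessThan power_mult_distrib mult_ac)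
  then have "kernel_det (\<lambda>z w. \<Sum>k<n. 1 / complex_of_real (c k) * (z * cnj w) ^ k) n z =
      Determinant.det (V z) * (Determinant.det D * Determinant.det W)"
    unfolding kernel_det_def
    by (simp only: det_mult[OF carrier(1) mult_carrier_mat[OF carrier(2,3)]]
        det_mult[OF carrier(2,3)] det_transpose[OF carrier(4)])
  also have "Determinant.det D = of_real (1 / (\<Prod>k<n. c k))"
  proof -
    have "upper_triangular D"
      by (auto simp: upper_triangular_def D_def)
    then have "Determinant.det D = (\<Prod>k<n. D $$ (k, k))"
      using carrier(2) by (simp add: det_upper_triangular prod_list_diag_prod atLeast0LessThan)
    then show ?thesis
      by (simp add: D_def prod_dividef)
  qed
  also have "Determinant.det W = cnj (Determinant.det (V z))"
    by (simp add: W_def V_def det_vandermonde)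
  also have "Determinant.det (V z) * (of_real (1 / (\<Prod>k<n. c k)) * cnj (Determinant.det (V z))) =
      of_real ((cmod (Determinant.det (V z)))\<^sup>2 / (\<Prod>k<n. c k))"
    using complex_norm_square[of "Determinant.det (V z)"] by simp
  also have "(cmod (Determinant.det (V z)))\<^sup>2 = (\<Prod>k<n. \<Prod>j<k. (cmod (z j - z k))\<^sup>2)"
    by (simp add: V_def det_vandermonde prod_norm[symmetric] prod_power_distrib norm_minus_commute)
  finally show ?thesis .
qed

subsection \<open>Densities on finite products\<close>

text \<open>This moves weights of single coordinates between a density and the background measure.
  Both measures agree on rectangles, and sigma-finiteness makes that decisive.\<close>

lemma PiM_density:
  assumes "sigma_finite_measure N" "sigma_finite_measure (density N g)" "finite I"
    and g [measurable]: "g \<in> borel_measurable N"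
  shows "PiM I (\<lambda>_. density N g) = density (PiM I (\<lambda>_. N)) (\<lambda>x. \<Prod>i\<in>I. g (x i))"
proof -
  interpret P: product_sigma_finite "\<lambda>_. N"
    by (rule product_sigma_finite.intro) (rule assms)
  interpret Q: product_sigma_finite "\<lambda>_. density N g"
    by (rule product_sigma_finite.intro) (rule assms)
  show ?thesis
  proof (rule sym, rule Q.PiM_eqI[OF \<open>finite I\<close>])
    fix A assume "\<And>i. i \<in> I \<Longrightarrow> A i \<in> sets (density N g)"
    then have A [measurable]: "A i \<in> sets N" if "i \<in> I" for i
      using that by auto
    have "emeasure (density (PiM I (\<lambda>_. N)) (\<lambda>x. \<Prod>i\<in>I. g (x i))) (Pi\<^sub>E I A) =
        (\<integral>\<^sup>+x. (\<Prod>i\<in>I. g (x i)) * indicator (Pi\<^sub>E I A) x \<partial>PiM I (\<lambda>_. N))"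
      using \<open>finite I\<close> A by (subst emeasure_density) (auto intro!: sets_PiM_I_finite)
    \<comment> \<open>Points of the space are extensional, so membership in
      \<open>Pi\<^sub>E I A\<close> is decided coordinatewise and the indicator splits into a
      product.\<close>
    also have "\<dots> = (\<integral>\<^sup>+x. (\<Prod>i\<in>I. g (x i) * indicator (A i) (x i)) \<partial>PiM I (\<lambda>_. N))"
      using \<open>finite I\<close>
      by (intro nn_integral_cong)
         (auto simp: prod.distrib space_PiM PiE_iff indicator_def prod_zero_iff extensional_def
               intro!: prod.neutral)
    also have "\<dots> = (\<Prod>i\<in>I. \<integral>\<^sup>+x. g x * indicator (A i) x \<partial>N)"
      using \<open>finite I\<close> A by (intro P.product_nn_integral_prod) auto
    also have "\<dots> = (\<Prod>i\<in>I. emeasure (density N g) (A i))"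
      using A by (intro prod.cong) (auto simp: emeasure_density)
    finally show "emeasure (density (PiM I (\<lambda>_. N)) (\<lambda>x. \<Prod>i\<in>I. g (x i))) (Pi\<^sub>E I A) =
        (\<Prod>i\<in>I. emeasure (density N g) (A i))" .
  qed (auto intro!: sets_PiM_cong)
qed

text \<open>Tonelli, with coordinate k split off as the inner variable.\<close>

lemma distributed_first_vars_marginal:
  assumes "sigma_finite_measure N"
    and Z: "distributed M (PiM {..<Suc k} (\<lambda>_. N)) (first_vars (Suc k) Z) f"
  shows "distributed M (PiM {..<k} (\<lambda>_. N)) (first_vars k Z) (\<lambda>z. \<integral>\<^sup>+x. f (z(k := x)) \<partial>N)"
proof -
  interpret N: sigma_finite_measure N by fact
  interpret P: product_sigma_finite "\<lambda>_. N"
    by (rule product_sigma_finite.intro) (rule assms)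
  have ins: "{..<Suc k} = insert k {..<k}" by auto
  have f: "f \<in> borel_measurable (PiM (insert k {..<k}) (\<lambda>_. N))"
    using distributed_borel_measurable[OF Z] by (simp add: ins)
  have [measurable]: "(\<lambda>(z, x). f (z(k := x))) \<in> borel_measurable (PiM {..<k} (\<lambda>_. N) \<Otimes>\<^sub>M N)"
    using measurable_comp[OF measurable_add_dim f] by (simp add: comp_def split_beta')
  have marg [measurable]: "(\<lambda>z. \<integral>\<^sup>+x. f (z(k := x)) \<partial>N) \<in> borel_measurable (PiM {..<k} (\<lambda>_. N))"
    by measurable
  have res [measurable]:
    "(\<lambda>z. restrict z {..<k}) \<in> PiM {..<Suc k} (\<lambda>_. N) \<rightarrow>\<^sub>M PiM {..<k} (\<lambda>_. N)"
    by (rule measurable_restrict_subset) auto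
  have first: "first_vars k Z = (\<lambda>\<omega>. restrict (first_vars (Suc k) Z \<omega>) {..<k})"
    by (auto simp: first_vars_def fun_eq_iff restrict_def)
  have X [measurable]: "first_vars (Suc k) Z \<in> M \<rightarrow>\<^sub>M PiM {..<Suc k} (\<lambda>_. N)"
    using distributed_measurable[OF Z] .
  have Xk [measurable]: "first_vars k Z \<in> M \<rightarrow>\<^sub>M PiM {..<k} (\<lambda>_. N)"
    unfolding first by measurable
  have "distr M (PiM {..<k} (\<lambda>_. N)) (first_vars k Z) =
      density (PiM {..<k} (\<lambda>_. N)) (\<lambda>z. \<integral>\<^sup>+x. f (z(k := x)) \<partial>N)"
  proof (rule measure_eqI)
    fix A assume "A \<in> sets (distr M (PiM {..<k} (\<lambda>_. N)) (first_vars k Z))"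
    then have A [measurable]: "A \<in> sets (PiM {..<k} (\<lambda>_. N))" by simp
    have "emeasure (distr M (PiM {..<k} (\<lambda>_. N)) (first_vars k Z)) A =
        (\<integral>\<^sup>+z. indicator A z \<partial>distr M (PiM {..<k} (\<lambda>_. N)) (first_vars k Z))"
      by simp
    also have "\<dots> = (\<integral>\<^sup>+\<omega>. indicator A (restrict (first_vars (Suc k) Z \<omega>) {..<k}) \<partial>M)"
      by (subst nn_integral_distr) (auto simp: first)
    also have "\<dots> = (\<integral>\<^sup>+z. f z * indicator A (restrict z {..<k}) \<partial>PiM {..<Suc k} (\<lambda>_. N))"
      by (rule distributed_nn_integral[OF Z, symmetric]) measurable
    also have "\<dots> = (\<integral>\<^sup>+z. \<integral>\<^sup>+x. f (z(k := x)) * indicator A (restrict (z(k := x)) {..<k}) \<partial>N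
        \<partial>PiM {..<k} (\<lambda>_. N))"
      unfolding ins using f res
      by (subst P.product_nn_integral_insert) (auto simp: ins intro!: borel_measurable_times_ennreal)
    also have "\<dots> = (\<integral>\<^sup>+z. (\<integral>\<^sup>+x. f (z(k := x)) \<partial>N) * indicator A z \<partial>PiM {..<k} (\<lambda>_. N))"
    proof (intro nn_integral_cong)
      fix z assume z: "z \<in> space (PiM {..<k} (\<lambda>_. N))"
      \<comment> \<open>An element of this space is \<open>undefined\<close> outside
        \<open>{..<k}\<close>, so cutting \<open>z(k := x)\<close> back gives z itself, not just a
        function agreeing with z on the indices below k.\<close>
      then have "restrict (z(k := x)) {..<k} = z" for x
        by (auto simp: space_PiM fun_eq_iff PiE_iff extensional_def)
      moreover have "(\<lambda>x. f (z(k := x))) \<in> borel_measurable N"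
        using measurable_comp[OF measurable_component_update f, OF z] by (simp add: comp_def del: fun_upd_apply)
      ultimately show "(\<integral>\<^sup>+x. f (z(k := x)) * indicator A (restrict (z(k := x)) {..<k}) \<partial>N) =
          (\<integral>\<^sup>+x. f (z(k := x)) \<partial>N) * indicator A z"
        by (simp add: nn_integral_multc)
    qed
    also have "\<dots> = emeasure (density (PiM {..<k} (\<lambda>_. N)) (\<lambda>z. \<integral>\<^sup>+x. f (z(k := x)) \<partial>N)) A"
      by (simp add: emeasure_density)
    finally show "emeasure (distr M (PiM {..<k} (\<lambda>_. N)) (first_vars k Z)) A =
        emeasure (density (PiM {..<k} (\<lambda>_. N)) (\<lambda>z. \<integral>\<^sup>+x. f (z(k := x)) \<partial>N)) A" .
  qed simp
  then show ?thesis
    by (simp add: distributed_def)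
qed

subsection \<open>Kernels of finite-rank projections\<close>

text \<open>The data of an orthogonal projection of rank n: \<open>reproducing\<close> is
  idempotence of the integral operator, \<open>hermitian\<close> self-adjointness,
  \<open>trace\<close> the rank. They are imposed at all points, so that the determinant identities
  hold at every configuration and not just almost everywhere. Nonnegativity is asked for n points
  only; fewer points inherit it.\<close>

locale reproducing_kernel =
  fixes K :: "complex \<Rightarrow> complex \<Rightarrow> complex" and \<nu> :: "complex measure" and n :: nat
  assumes sigma_finite: "sigma_finite_measure \<nu>"
    and sets_eq: "sets \<nu> = sets borel"
    and hermitian: "cnj (K z w) = K w z"
    and measurable_kernel: "(\<lambda>(z, w). K z w) \<in> borel_measurable (\<nu> \<Otimes>\<^sub>M \<nu>)"
    and trace: "has_bochner_integral \<nu> (\<lambda>x. K x x) (of_nat n)"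
    and reproducing: "has_bochner_integral \<nu> (\<lambda>x. K z x * K x w) (K z w)"
    and kernel_det_top_nonneg: "kernel_det K n v \<in> \<real>\<^sub>\<ge>\<^sub>0"
begin

lemma measurable_kernel_det [measurable]: "kernel_det K k \<in> borel_measurable (PiM {..<k} (\<lambda>_. \<nu>))"
proof -
  have K: "(\<lambda>z. K (z i) (z j)) \<in> borel_measurable (PiM {..<k} (\<lambda>_. \<nu>))" if "i < k" "j < k" for i j
  proof -
    have "(\<lambda>z. (z i, z j)) \<in> PiM {..<k} (\<lambda>_. \<nu>) \<rightarrow>\<^sub>M \<nu> \<Otimes>\<^sub>M \<nu>"
      using that by (intro measurable_Pair measurable_component_singleton) auto
    from measurable_compose[OF this measurable_kernel] show ?thesis
      by simp
  qed
  have p: "p i < k" if "p permutes {0..<k}" "i < k" for p i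
    using that permutes_in_image[of p "{0..<k}" i] by simp
  have "kernel_det K k z = (\<Sum>p | p permutes {0..<k}. signof p * (\<Prod>i = 0..<k. K (z i) (z (p i))))"
    for z
    unfolding kernel_det_def
    by (subst det_def'[of _ k]) (auto simp: p intro!: sum.cong prod.cong)
  moreover have "(\<lambda>z. \<Sum>p | p permutes {0..<k}. signof p * (\<Prod>i = 0..<k. K (z i) (z (p i))))
      \<in> borel_measurable (PiM {..<k} (\<lambda>_. \<nu>))"
  proof (rule borel_measurable_sum)
    fix q assume "q \<in> {p. p permutes {0..<k}}"
    then have "(\<lambda>z. \<Prod>i = 0..<k. K (z i) (z (q i))) \<in> borel_measurable (PiM {..<k} (\<lambda>_. \<nu>))"
      by (intro borel_measurable_prod K) (auto simp: p)
    then show "(\<lambda>z. signof q * (\<Prod>i = 0..<k. K (z i) (z (q i))))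
        \<in> borel_measurable (PiM {..<k} (\<lambda>_. \<nu>))"
      by (intro borel_measurable_times borel_measurable_const)
  qed
  ultimately show ?thesis
    by (simp cong: measurable_cong)
qed

text \<open>After \<open>det_bordered\<close>, x occurs only in K x x and in the products K (z i) x
  * K x (z l), which are exactly what \<open>trace\<close> and \<open>reproducing\<close> integrate.
  The subtraction is complex, hence not truncated when k > n.\<close>

lemma has_bochner_integral_kernel_det:
  "has_bochner_integral \<nu> (\<lambda>x. kernel_det K (Suc k) (z(k := x)))
     ((of_nat n - of_nat k) * kernel_det K k z)"
proof -
  define B where "B = Matrix.mat k k (\<lambda>(j, l). K (z j) (z l))"
  have B: "B \<in> carrier_mat k k"
    by (simp add: B_def)
  have border: "kernel_det K (Suc k) (z(k := x)) = K x x * Determinant.det B -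
      (\<Sum>i<k. \<Sum>l<k. K (z i) x * K x (z l) * cofactor B i l)" for x
  proof -
    define A where "A = Matrix.mat (Suc k) (Suc k) (\<lambda>(j, l). K ((z(k := x)) j) ((z(k := x)) l))"
    have A: "A \<in> carrier_mat (Suc k) (Suc k)"
      by (simp add: A_def)
    have "mat_delete A k k = B"
      by (rule eq_matI) (auto simp: A_def B_def mat_delete_def)
    then show ?thesis
      using det_bordered[OF A] by (simp add: kernel_det_def A_def)
  qed
  have "has_bochner_integral \<nu> (\<lambda>x. K x x * Determinant.det B -
      (\<Sum>i<k. \<Sum>l<k. K (z i) x * K x (z l) * cofactor B i l))
    (of_nat n * Determinant.det B - (\<Sum>i<k. \<Sum>l<k. K (z i) (z l) * cofactor B i l))"
    by (intro has_bochner_integral_diff has_bochner_integral_sum has_bochner_integral_mult_left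
        trace reproducing)
  \<comment> \<open>Laplace expansion of the old determinant along row i; the k rows together
    account for the - k.\<close>
  moreover have "(\<Sum>l<k. K (z i) (z l) * cofactor B i l) = Determinant.det B" if "i < k" for i
    using that by (subst laplace_expansion_row[OF B that]) (auto simp: B_def)
  ultimately show ?thesis
    unfolding border by (simp add: kernel_det_def B_def[symmetric] algebra_simps)
qed

text \<open>Up to the factor n - k, the k-point determinant is an integral of (k + 1)-point
  determinants, so nonnegativity descends from n points.\<close>

lemma kernel_det_nonneg:
  assumes "k \<le> n"
  shows "kernel_det K k z \<in> \<real>\<^sub>\<ge>\<^sub>0"
  using assms
proof (induction arbitrary: z rule: inc_induct)
  case base
  show ?case by (rule kernel_det_top_nonneg)
next
  case (step k)
  define d where "d = (of_nat n - of_nat k) * kernel_det K k z"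
  have int: "has_bochner_integral \<nu> (\<lambda>x. kernel_det K (Suc k) (z(k := x))) d"
    unfolding d_def by (rule has_bochner_integral_kernel_det)
  have nonneg: "0 \<le> Re (kernel_det K (Suc k) (z(k := x)))"
      "Im (kernel_det K (Suc k) (z(k := x))) = 0" for x
    using step.IH by (auto simp: complex_nonneg_Reals_iff)
  have "has_bochner_integral \<nu> (\<lambda>x. Re (kernel_det K (Suc k) (z(k := x)))) (Re d)"
    by (rule has_bochner_integral_Re[OF int])
  then have "0 \<le> Re d"
    using nonneg(1) Bochner_Integration.integral_nonneg[of \<nu> "\<lambda>x. Re (kernel_det K (Suc k) (z(k := x)))"]
    by (simp add: has_bochner_integral_iff del: fun_upd_apply)
  moreover have "has_bochner_integral \<nu> (\<lambda>x. Im (kernel_det K (Suc k) (z(k := x)))) (Im d)"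
    by (rule has_bochner_integral_Im[OF int])
  then have "Im d = 0"
    using nonneg(2) by (simp add: has_bochner_integral_iff del: fun_upd_apply)
  moreover have "d = of_real (real n - real k) * kernel_det K k z"
    by (simp add: d_def)
  then have "Re d = (real n - real k) * Re (kernel_det K k z)"
    "Im d = (real n - real k) * Im (kernel_det K k z)"
    by simp_all
  \<comment> \<open>Strictness lets the factor be cancelled, both in the sign of the real part and
    in the vanishing of the imaginary part.\<close>
  moreover have "real n - real k > 0"
    using \<open>k < n\<close> by simp
  ultimately show ?case
    by (simp add: complex_nonneg_Reals_iff zero_le_mult_iff)
qed

text \<open>The passage to \<open>ennreal\<close> is safe because k < n keeps k + 1 points within
  the range of \<open>kernel_det_nonneg\<close>. The constant a will be 1 for the total mass and (n
  - k - 1)! / n! for the marginals.\<close>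

lemma nn_integral_kernel_det:
  assumes "k < n" "a \<ge> 0"
  shows "(\<integral>\<^sup>+x. ennreal (a * Re (kernel_det K (Suc k) (z(k := x)))) \<partial>\<nu>) =
    ennreal (a * (real (n - k) * Re (kernel_det K k z)))"
proof -
  define F where "F x = a * Re (kernel_det K (Suc k) (z(k := x)))" for x
  have "has_bochner_integral \<nu> F (a * Re ((of_nat n - of_nat k) * kernel_det K k z))"
    unfolding F_def
    by (intro has_bochner_integral_mult_right has_bochner_integral_Re has_bochner_integral_kernel_det)
  moreover have "Re ((of_nat n - of_nat k) * kernel_det K k z) = real (n - k) * Re (kernel_det K k z)"
    using assms by simp
  ultimately have int: "has_bochner_integral \<nu> F (a * (real (n - k) * Re (kernel_det K k z)))"
    by (simp only:)
  have "0 \<le> F x" for x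
    using kernel_det_nonneg[of "Suc k" "z(k := x)"] assms
    by (simp add: F_def complex_nonneg_Reals_iff)
  then have "(\<integral>\<^sup>+x. ennreal (F x) \<partial>\<nu>) = ennreal (integral\<^sup>L \<nu> F)"
    using int by (intro nn_integral_eq_integral) (auto simp: has_bochner_integral_iff)
  then show ?thesis
    using int by (simp add: F_def has_bochner_integral_iff del: fun_upd_apply)
qed

text \<open>Going from j + 1 points to j gives the factor n - j, and these multiply to n! / (n - k)!
  over j < k. The case k = n determines the normalising constant.\<close>

lemma nn_integral_kernel_det_PiM:
  assumes "k \<le> n"
  shows "(\<integral>\<^sup>+z. ennreal (Re (kernel_det K k z)) \<partial>PiM {..<k} (\<lambda>_. \<nu>)) = ennreal (fact n / fact (n - k))"
  using assms
proof (induction k)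
  case 0
  interpret product_sigma_finite "\<lambda>_. \<nu>"
    by (rule product_sigma_finite.intro) (rule sigma_finite)
  \<comment> \<open>The empty product space is one point of mass 1, and the empty matrix has
    determinant 1.\<close>
  show ?case
    by (simp add: nn_integral_empty kernel_det_def del: nn_integral_const)
next
  case (Suc k)
  interpret product_sigma_finite "\<lambda>_. \<nu>"
    by (rule product_sigma_finite.intro) (rule sigma_finite)
  have ins: "{..<Suc k} = insert k {..<k}" by auto
  have f: "(\<lambda>z. ennreal (Re (kernel_det K (Suc k) z))) \<in> borel_measurable (PiM (insert k {..<k}) (\<lambda>_. \<nu>))"
    unfolding ins[symmetric] by measurable
  have "(\<integral>\<^sup>+z. ennreal (Re (kernel_det K (Suc k) z)) \<partial>PiM {..<Suc k} (\<lambda>_. \<nu>)) =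
      (\<integral>\<^sup>+z. \<integral>\<^sup>+x. ennreal (Re (kernel_det K (Suc k) (z(k := x)))) \<partial>\<nu> \<partial>PiM {..<k} (\<lambda>_. \<nu>))"
    unfolding ins by (rule product_nn_integral_insert[OF _ _ f]) auto
  also have "\<dots> = (\<integral>\<^sup>+z. ennreal (real (n - k)) * ennreal (Re (kernel_det K k z)) \<partial>PiM {..<k} (\<lambda>_. \<nu>))"
    using nn_integral_kernel_det[of k 1] Suc.prems by (simp add: ennreal_mult')
  also have "\<dots> = ennreal (real (n - k)) * ennreal (fact n / fact (n - k))"
    using Suc by (subst nn_integral_cmult) auto
  also have "\<dots> = ennreal (fact n / fact (n - Suc k))"
  proof -
    have "fact (n - k) = real (n - k) * fact (n - Suc k)"
      using Suc.prems by (simp add: fact_reduce)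
    then show ?thesis
      using Suc.prems by (simp add: ennreal_mult'[symmetric])
  qed
  finally show ?case .
qed

lemma determinantal_point_process:
  assumes Z: "distributed M (PiM {..<n} (\<lambda>_. \<nu>)) (first_vars n Z)
    (\<lambda>z. ennreal (Re (kernel_det K n z) / fact n))"
  shows "determinantal_point_process M n Z K \<nu>"
proof -
  have "distributed M (PiM {..<k} (\<lambda>_. \<nu>)) (first_vars k Z)
      (\<lambda>z. ennreal (fact (n - k) / fact n * Re (kernel_det K k z)))" if "k \<le> n" for k
    using that
  proof (induction rule: inc_induct)
    case base
    show ?case using Z by simp
  next
    case (step k)
    \<comment> \<open>The n - k gained by integration completes (n - k - 1)! to (n - k)!.\<close>
    have "fact (n - k) = real (n - k) * fact (n - Suc k)"
      using \<open>k < n\<close> by (simp add: fact_reduce)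
    then have "(\<integral>\<^sup>+x. ennreal (fact (n - Suc k) / fact n * Re (kernel_det K (Suc k) (z(k := x)))) \<partial>\<nu>) =
        ennreal (fact (n - k) / fact n * Re (kernel_det K k z))" for z
      by (subst nn_integral_kernel_det[OF \<open>k < n\<close>]) (simp_all add: mult_ac)
    then show ?case
      using distributed_first_vars_marginal[OF sigma_finite step.IH] by (simp only:)
  qed
  then show ?thesis
    by (auto simp: determinantal_point_process_def sets_eq hermitian kernel_det_nonneg)
qed

end

subsection \<open>Radial weights\<close>

lemma measurable_cnj [measurable]: "cnj \<in> borel_measurable borel"
  by (intro borel_measurable_continuous_onI continuous_intros)

text \<open>Substituting u * z for z with u on the unit circle preserves the measure and multiplies
  the integral by u^a * cnj u^b; if some u makes this differ from 1, the integral is 0. For a = b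
  the integrand is the power of the modulus covered by \<open>norms\<close>.\<close>

lemma has_bochner_integral_radial_monomial:
  fixes g :: "real \<Rightarrow> real"
  assumes g [measurable]: "g \<in> borel_measurable borel" and g_nonneg: "\<And>x. g x \<ge> 0"
    and norms: "\<And>k. k < n \<Longrightarrow>
      (\<integral>\<^sup>+z. ennreal (cmod z ^ (2 * k)) \<partial>density lborel (\<lambda>z. ennreal (g (cmod z)))) = ennreal (c k)"
    and c_nonneg: "\<And>k. k < n \<Longrightarrow> 0 \<le> c k"
    and ab: "a < n" "b < n"
  shows "has_bochner_integral (density lborel (\<lambda>z. ennreal (g (cmod z)))) (\<lambda>z. z ^ a * cnj z ^ b)
    (if a = b then of_real (c a) else 0)"
proof -
  define \<nu> where "\<nu> = density lborel (\<lambda>z. ennreal (g (cmod z)))"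
  have sets [measurable_cong]: "sets \<nu> = sets borel"
    by (simp add: \<nu>_def)
  have sq: "has_bochner_integral \<nu> (\<lambda>z. cmod z ^ (2 * k)) (c k)" if "k < n" for k
    using norms[OF that] c_nonneg[OF that]
    by (intro has_bochner_integral_nn_integral) (auto simp: \<nu>_def)
  have "integrable \<nu> (\<lambda>z. z ^ a * cnj z ^ b)"
  proof (rule Bochner_Integration.integrable_bound)
    show "integrable \<nu> (\<lambda>z. cmod z ^ (2 * a) + cmod z ^ (2 * b))"
      using sq ab by (auto simp: has_bochner_integral_iff)
    \<comment> \<open>Only even moments are known to be finite; the arithmetic-geometric mean
      inequality bounds the mixed one by two of them.\<close>
    have "r ^ a * r ^ b \<le> r ^ (2 * a) + r ^ (2 * b)" if "r \<ge> 0" for r :: real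
    proof -
      have "2 * (r ^ a * r ^ b) \<le> (r ^ a)\<^sup>2 + (r ^ b)\<^sup>2" "0 \<le> r ^ a * r ^ b"
        using sum_squares_bound[of "r ^ a" "r ^ b"] that by auto
      then show ?thesis
        by (simp add: power_mult power_commutes flip: power_mult) (simp add: mult.commute)
    qed
    then show "AE z in \<nu>. norm (z ^ a * cnj z ^ b) \<le> norm (cmod z ^ (2 * a) + cmod z ^ (2 * b))"
      by (auto simp: norm_mult norm_power)
  qed measurable
  moreover have "(\<integral>z. z ^ a * cnj z ^ b \<partial>\<nu>) = (if a = b then of_real (c a) else 0)"
  proof (cases "a = b")
    case True
    have "z ^ a * cnj z ^ a = of_real (cmod z ^ (2 * a))" for z
      by (simp add: power_mult_distrib[symmetric] complex_norm_square[symmetric] power_mult)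
    then have "(\<integral>z. z ^ a * cnj z ^ b \<partial>\<nu>) = of_real (\<integral>z. cmod z ^ (2 * a) \<partial>\<nu>)"
      using True by (simp only: integral_complex_of_real)
    then show ?thesis
      using True sq[OF ab(1)] by (simp add: has_bochner_integral_iff)
  next
    case False
    define m where "m = real_of_int \<bar>int a - int b\<bar>"
    have m: "1 \<le> m"
      using False by (simp add: m_def)
    \<comment> \<open>This angle turns u^a * cnj u^b into i or - i, hence not 1. It lies strictly
      between 0 and pi, so Im u \<noteq> 0, as \<open>distr_lborel_rotate\<close> demands.\<close>
    define u where "u = cis (pi / (2 * m))"
    have "0 < pi / (2 * m)" "pi / (2 * m) < pi"
      using m by (auto simp: divide_less_eq)
    then have u: "cmod u = 1" "Im u \<noteq> 0"
      using sin_gt_zero by (fastforce simp: u_def)+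
    have "u ^ a * cnj u ^ b = cis ((real a - real b) * (pi / (2 * m)))"
      unfolding u_def cis_cnj Complex.DeMoivre cis_mult by (simp add: left_diff_distrib diff_divide_distrib)
    moreover have "(real a - real b) * (pi / (2 * m)) = pi / 2 \<or> (real a - real b) * (pi / (2 * m)) = - (pi / 2)"
      using m by (auto simp: m_def abs_if field_simps)
    ultimately have "u ^ a * cnj u ^ b = cis (pi / 2) \<or> u ^ a * cnj u ^ b = cis (- (pi / 2))"
      by presburger
    then have ne: "u ^ a * cnj u ^ b \<noteq> 1"
      by (elim disjE) (simp_all only: complex_eq_iff cis.simps one_complex.simps cos_minus cos_pi_half, simp_all)
    have "distr \<nu> borel (\<lambda>z. u * z) = \<nu>"
    proof -
      have "distr (density lborel (\<lambda>z. ennreal (g (cmod (u * z))))) borel (\<lambda>z. u * z) =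
          density (distr lborel borel (\<lambda>z. u * z)) (\<lambda>z. ennreal (g (cmod z)))"
        by (rule density_distr[symmetric]) auto
      then show ?thesis
        by (simp add: \<nu>_def norm_mult u distr_lborel_rotate)
    qed
    then have "(\<integral>z. z ^ a * cnj z ^ b \<partial>\<nu>) = (\<integral>z. z ^ a * cnj z ^ b \<partial>distr \<nu> borel (\<lambda>z. u * z))"
      by simp
    also have "\<dots> = (\<integral>z. (u ^ a * cnj u ^ b) * (z ^ a * cnj z ^ b) \<partial>\<nu>)"
      by (subst integral_distr) (auto simp: power_mult_distrib mult_ac)
    also have "\<dots> = u ^ a * cnj u ^ b * (\<integral>z. z ^ a * cnj z ^ b \<partial>\<nu>)"
      by simp
    finally show ?thesis
      using False ne by auto
  qed
  ultimately show ?thesis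
    by (simp add: has_bochner_integral_iff \<nu>_def)
qed

text \<open>Polar coordinates contribute the 2 * pi and one more power of x, whence the exponent 2 *
  k + 1 in c k. Finiteness of the moment matters because the Bochner integral of a non-integrable
  function is 0 by convention.\<close>

lemma nn_integral_monomial_radial:
  fixes \<phi> :: "real \<Rightarrow> real"
  assumes meas: "\<phi> \<in> borel_measurable (restrict_space borel {0..})"
    and nonneg: "\<And>x. x \<ge> 0 \<Longrightarrow> \<phi> x \<ge> 0"
    and finite: "(\<integral>\<^sup>+y\<in>{0..}. ennreal (y ^ (2 * k + 1) * \<phi> y) \<partial>lborel) < \<infinity>"
  shows "(\<integral>\<^sup>+z. ennreal (cmod z ^ (2 * k)) \<partial>density lborel (\<lambda>z. ennreal (\<phi> (cmod z)))) =
      ennreal (2 * pi * (LBINT x:{0..}. x ^ (2 * k + 1) * \<phi> x))" (is ?norm)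
    and "ennreal (LBINT x:{0..}. x ^ (2 * k + 1) * \<phi> x) =
      (\<integral>\<^sup>+y\<in>{0..}. ennreal (y ^ (2 * k + 1) * \<phi> y) \<partial>lborel)" (is ?real)
proof -
  \<comment> \<open>\<phi> is Borel only on the half-line and unconstrained elsewhere; its extension
    by 0 is Borel on the whole line and has the same values at every cmod z.\<close>
  define \<psi> where "\<psi> x = indicator {0..} x * \<phi> x" for x
  have \<psi> [measurable]: "\<psi> \<in> borel_measurable borel"
    using borel_measurable_restrict_space_iff[of "{0..}" borel \<phi>] meas by (simp add: \<psi>_def[abs_def])
  have \<phi>\<psi>: "\<phi> x = \<psi> x" if "x \<ge> 0" for x
    using that by (simp add: \<psi>_def)
  have \<psi>_nonneg: "\<psi> x \<ge> 0" for x
    using nonneg by (auto simp: \<psi>_def indicator_def)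
  define h where "h x = indicator {0..} x * (x ^ (2 * k + 1) * \<phi> x)" for x :: real
  have h: "h = (\<lambda>x. x ^ (2 * k + 1) * \<psi> x)"
    by (auto simp: h_def \<psi>_def)
  have h_nonneg: "h x \<ge> 0" for x
    using nonneg by (auto simp: h_def indicator_def)
  have [measurable]: "h \<in> borel_measurable borel"
    unfolding h by measurable
  have I: "(\<integral>\<^sup>+y\<in>{0..}. ennreal (y ^ (2 * k + 1) * \<phi> y) \<partial>lborel) = (\<integral>\<^sup>+x. ennreal (h x) \<partial>lborel)"
    by (intro nn_integral_cong) (auto simp: h_def indicator_def)
  have L: "(LBINT x:{0..}. x ^ (2 * k + 1) * \<phi> x) = integral\<^sup>L lborel h"
    by (simp add: set_lebesgue_integral_def h_def[abs_def])
  have int: "integrable lborel h"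
    using finite[unfolded I] h_nonneg by (intro integrableI_nonneg) auto
  then have eq: "(\<integral>\<^sup>+x. ennreal (h x) \<partial>lborel) = ennreal (integral\<^sup>L lborel h)"
    using h_nonneg by (intro nn_integral_eq_integral) auto
  show ?real
    unfolding L I eq ..
  have "(\<integral>\<^sup>+z. ennreal (cmod z ^ (2 * k)) \<partial>density lborel (\<lambda>z. ennreal (\<phi> (cmod z)))) =
      (\<integral>\<^sup>+z. ennreal (\<psi> (cmod z) * cmod z ^ (2 * k)) \<partial>lborel)"
    by (simp add: \<phi>\<psi> nn_integral_density ennreal_mult' \<psi>_nonneg)
  also have "\<dots> = (\<integral>\<^sup>+x\<in>{0..}. ennreal (2 * pi * x) * ennreal (\<psi> x * x ^ (2 * k)) \<partial>lborel)"
    by (rule nn_integral_radial) measurable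
  also have "\<dots> = (\<integral>\<^sup>+x. ennreal (2 * pi) * ennreal (h x) \<partial>lborel)"
  proof (intro nn_integral_cong)
    fix x :: real
    show "ennreal (2 * pi * x) * ennreal (\<psi> x * x ^ (2 * k)) * indicator {0..} x =
        ennreal (2 * pi) * ennreal (h x)"
    proof (cases "x \<ge> 0")
      case True
      then show ?thesis
        using \<psi>_nonneg[of x] by (simp add: h ennreal_mult[symmetric] mult_ac)
    qed (simp add: h \<psi>_def)
  qed
  also have "\<dots> = ennreal (2 * pi * integral\<^sup>L lborel h)"
    using nn_integral_cmult[of "\<lambda>x. ennreal (h x)" lborel "ennreal (2 * pi)"]
    by (simp only: eq ennreal_mult'[of "2 * pi", symmetric]) (simp add: eq ennreal_mult')
  finally show ?norm
    unfolding L .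
qed

lemma reproducing_kernel_radial:
  fixes \<phi> :: "real \<Rightarrow> real"
  assumes meas: "\<phi> \<in> borel_measurable (restrict_space borel {0..})"
    and nonneg: "\<And>x. x \<ge> 0 \<Longrightarrow> \<phi> x \<ge> 0"
    and norms: "\<And>k. k < n \<Longrightarrow>
      (\<integral>\<^sup>+z. ennreal (cmod z ^ (2 * k)) \<partial>density lborel (\<lambda>z. ennreal (\<phi> (cmod z)))) = ennreal (c k)"
    and c_pos: "\<And>k. k < n \<Longrightarrow> 0 < c k"
  shows "reproducing_kernel (\<lambda>z w. \<Sum>k<n. 1 / complex_of_real (c k) * (z * cnj w) ^ k)
    (density lborel (\<lambda>z. ennreal (\<phi> (cmod z)))) n"
proof -
  define \<psi> where "\<psi> x = indicator {0..} x * \<phi> x" for x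
  have \<psi> [measurable]: "\<psi> \<in> borel_measurable borel"
    using borel_measurable_restrict_space_iff[of "{0..}" borel \<phi>] meas by (simp add: \<psi>_def[abs_def])
  have \<phi>\<psi>: "\<phi> (cmod z) = \<psi> (cmod z)" for z
    by (simp add: \<psi>_def)
  have \<psi>_nonneg: "\<psi> x \<ge> 0" for x
    using nonneg by (auto simp: \<psi>_def indicator_def)
  define \<nu> where "\<nu> = density lborel (\<lambda>z. ennreal (\<psi> (cmod z)))"
  have sets [measurable_cong]: "sets \<nu> = sets borel"
    by (simp add: \<nu>_def)
  define K where "K z w = (\<Sum>k<n. 1 / complex_of_real (c k) * (z * cnj w) ^ k)" for z w
  have mono: "has_bochner_integral \<nu> (\<lambda>z. z ^ a * cnj z ^ b) (if a = b then of_real (c a) else 0)"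
    if "a < n" "b < n" for a b
    unfolding \<nu>_def
    by (rule has_bochner_integral_radial_monomial[OF \<psi> \<psi>_nonneg norms[unfolded \<phi>\<psi>] less_imp_le[OF c_pos] that])
  have "reproducing_kernel K \<nu> n"
  proof
    \<comment> \<open>The density is real-valued, so it is finite everywhere, and that preserves
      sigma-finiteness.\<close>
    have "sigma_finite_measure \<nu>"
      unfolding \<nu>_def by (subst sigma_finite_measure.sigma_finite_iff_density_finite[OF sigma_finite_lborel]) auto
    then show "\<exists>A. countable A \<and> A \<subseteq> sets \<nu> \<and> \<Union> A = space \<nu> \<and> (\<forall>a\<in>A. emeasure \<nu> a \<noteq> \<infinity>)"
      by (rule sigma_finite_measure.sigma_finite_countable)
    show "sets \<nu> = sets borel" by (rule sets)
    show "cnj (K z w) = K w z" for z w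
      by (simp add: K_def mult.commute)
    show "(\<lambda>(z, w). K z w) \<in> borel_measurable (\<nu> \<Otimes>\<^sub>M \<nu>)"
      unfolding K_def by measurable
    show "has_bochner_integral \<nu> (\<lambda>x. K x x) (of_nat n)"
    proof -
      have "has_bochner_integral \<nu> (\<lambda>x. \<Sum>k<n. 1 / complex_of_real (c k) * (x ^ k * cnj x ^ k))
          (\<Sum>k<n. 1 / complex_of_real (c k) * (if k = k then of_real (c k) else 0))"
        by (intro has_bochner_integral_sum has_bochner_integral_mult_right mono) auto
      moreover have "(\<Sum>k<n. 1 / complex_of_real (c k) * (if k = k then of_real (c k) else 0)) =
          (\<Sum>k<n. 1)"
        by (intro sum.cong) (auto dest!: c_pos)
      ultimately show ?thesis
        by (simp add: K_def power_mult_distrib)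
    qed
    show "has_bochner_integral \<nu> (\<lambda>x. K z x * K x w) (K z w)" for z w
    proof -
      \<comment> \<open>Orthogonality keeps only the diagonal terms, where c k cancels one of the
        two factors 1 / c k.\<close>
      have "has_bochner_integral \<nu>
          (\<lambda>x. \<Sum>k<n. \<Sum>l<n. z ^ k * cnj w ^ l / (complex_of_real (c k) * complex_of_real (c l)) *
            (x ^ l * cnj x ^ k))
          (\<Sum>k<n. \<Sum>l<n. z ^ k * cnj w ^ l / (complex_of_real (c k) * complex_of_real (c l)) *
            (if l = k then of_real (c l) else 0))"
        by (intro has_bochner_integral_sum has_bochner_integral_mult_right mono) auto
      moreover have "(\<Sum>l<n. z ^ k * cnj w ^ l / (complex_of_real (c k) * complex_of_real (c l)) *
            (if l = k then of_real (c l) else 0)) = 1 / complex_of_real (c k) * (z * cnj w) ^ k"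
        if "k < n" for k
      proof -
        have "(\<Sum>l<n. z ^ k * cnj w ^ l / (complex_of_real (c k) * complex_of_real (c l)) *
            (if l = k then of_real (c l) else 0)) =
          (\<Sum>l<n. if l = k then z ^ k * cnj w ^ l / (complex_of_real (c k) * complex_of_real (c l)) *
            of_real (c l) else 0)"
          by (intro sum.cong) auto
        then show ?thesis
          using that c_pos[OF that] by (simp add: power_mult_distrib)
      qed
      moreover have "(\<Sum>k<n. \<Sum>l<n. z ^ k * cnj w ^ l / (complex_of_real (c k) * complex_of_real (c l)) *
            (x ^ l * cnj x ^ k)) = K z x * K x w" for x
        unfolding K_def sum_product by (intro sum.cong) (auto simp: power_mult_distrib)
      ultimately show ?thesis
        by (simp add: K_def)
    qed
    have "c k \<noteq> 0" if "k < n" for k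
      using c_pos[OF that] by simp
    then have det: "kernel_det K n v =
        of_real ((\<Prod>k<n. \<Prod>j<k. (cmod (v j - v k))\<^sup>2) / (\<Prod>k<n. c k))" for v
      unfolding K_def by (rule kernel_det_projection)
    have "0 \<le> (\<Prod>k<n. c k)"
      by (intro prod_nonneg less_imp_le c_pos) auto
    then show "kernel_det K n v \<in> \<real>\<^sub>\<ge>\<^sub>0" for v
      unfolding det nonneg_Reals_of_real_iff
      by (rule divide_nonneg_nonneg[rotated]) (auto intro!: prod_nonneg)
  qed
  then show ?thesis
    by (simp add: \<nu>_def K_def[abs_def] \<phi>\<psi>)
qed

section \<open>Change of background measure and normalisation\<close>

theorem proposition1:
  fixes n :: nat
    and \<phi> :: "real \<Rightarrow> real"
    and M :: "'a measure"
    and Z :: "nat \<Rightarrow> 'a \<Rightarrow> complex"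
    and C :: real
    and c :: "nat \<Rightarrow> real"
  assumes n: "n \<ge> 1"
    and \<phi>_measurable: "\<phi> \<in> borel_measurable (restrict_space borel {0..})"
    and \<phi>_nonneg: "\<And>x. x \<ge> 0 \<Longrightarrow> \<phi> x \<ge> 0"
    and moments_pos: "\<And>j. 1 \<le> j \<Longrightarrow> j \<le> n \<Longrightarrow>
          0 < (\<integral>\<^sup>+y\<in>{0..}. ennreal (y ^ (2 * j - 1) * \<phi> y) \<partial>lborel)"
    and moments_finite: "\<And>j. 1 \<le> j \<Longrightarrow> j \<le> n \<Longrightarrow>
          (\<integral>\<^sup>+y\<in>{0..}. ennreal (y ^ (2 * j - 1) * \<phi> y) \<partial>lborel) < \<infinity>"
    and M: "prob_space M"
    and Z_density: "distributed M (\<Pi>\<^sub>M i\<in>{..<n}. lborel) (first_vars n Z)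
          (\<lambda>z. ennreal (C * (\<Prod>k<n. \<Prod>j<k. (cmod (z j - z k))\<^sup>2) * (\<Prod>j<n. \<phi> (cmod (z j)))))"
    and c: "\<And>k. k < n \<Longrightarrow> c k = 2 * pi * (LBINT x:{0..}. x ^ (2 * k + 1) * \<phi> x)"
  shows "inverse C = fact n * (\<Prod>k<n. c k) \<and>
         determinantal_point_process M n Z
           (\<lambda>z w. \<Sum>k<n. 1 / complex_of_real (c k) * (z * cnj w) ^ k)
           (density lborel (\<lambda>z. ennreal (\<phi> (cmod z))))"
proof -
  define \<nu> where "\<nu> = density lborel (\<lambda>z. ennreal (\<phi> (cmod z)))"
  define K where "K = (\<lambda>z w. \<Sum>k<n. 1 / complex_of_real (c k) * (z * cnj w) ^ k)"
  \<comment> \<open>The moments are indexed by j = k + 1, so 2 * j - 1 is 2 * k + 1.\<close>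
  have fin: "(\<integral>\<^sup>+y\<in>{0..}. ennreal (y ^ (2 * k + 1) * \<phi> y) \<partial>lborel) < \<infinity>" if "k < n" for k
    using moments_finite[of "Suc k"] that by simp
  have norms: "(\<integral>\<^sup>+z. ennreal (cmod z ^ (2 * k)) \<partial>\<nu>) = ennreal (c k)" if "k < n" for k
    unfolding \<nu>_def c[OF that]
    by (rule nn_integral_monomial_radial(1)[OF \<phi>_measurable \<phi>_nonneg fin[OF that]])
  have c_pos: "0 < c k" if "k < n" for k
  proof -
    have "ennreal (LBINT x:{0..}. x ^ (2 * k + 1) * \<phi> x) =
        (\<integral>\<^sup>+y\<in>{0..}. ennreal (y ^ (2 * k + 1) * \<phi> y) \<partial>lborel)"
      by (rule nn_integral_monomial_radial(2)[OF \<phi>_measurable \<phi>_nonneg fin[OF that]])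
    also have "\<dots> > 0"
      using moments_pos[of "Suc k"] that by simp
    finally show ?thesis
      by (simp add: c[OF that] ennreal_less_zero_iff)
  qed
  interpret reproducing_kernel K \<nu> n
    unfolding K_def \<nu>_def
    by (intro reproducing_kernel_radial \<phi>_measurable \<phi>_nonneg c_pos norms[unfolded \<nu>_def])
  define P where "P = (\<Prod>k<n. c k)"
  have P: "P > 0"
    unfolding P_def using c_pos by (intro prod_pos) auto
  have "c k \<noteq> 0" if "k < n" for k
    using c_pos[OF that] by simp
  then have "kernel_det K n z = of_real ((\<Prod>k<n. \<Prod>j<k. (cmod (z j - z k))\<^sup>2) / P)" for z
    unfolding K_def P_def by (rule kernel_det_projection)
  then have det: "(\<Prod>k<n. \<Prod>j<k. (cmod (z j - z k))\<^sup>2) = P * Re (kernel_det K n z)" for z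
    using P by (simp only: Re_complex_of_real) simp
  have \<phi>c [measurable]: "(\<lambda>z. \<phi> (cmod z)) \<in> borel_measurable borel"
  proof -
    have "(\<lambda>x. indicator {0..} x * \<phi> x) \<in> borel_measurable borel"
      using borel_measurable_restrict_space_iff[of "{0..}" borel \<phi>] \<phi>_measurable by simp
    then have "(\<lambda>z. indicator {0..} (cmod z) * \<phi> (cmod z)) \<in> borel_measurable borel"
      by (rule measurable_compose[rotated]) measurable
    then show ?thesis by simp
  qed
  have PiM: "PiM {..<n} (\<lambda>_. \<nu>) =
      density (PiM {..<n} (\<lambda>_. lborel)) (\<lambda>z. \<Prod>j<n. ennreal (\<phi> (cmod (z j))))"
    unfolding \<nu>_def
    by (rule PiM_density) (use sigma_finite in \<open>auto simp: \<nu>_def intro: sigma_finite_lborel\<close>)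
  \<comment> \<open>The density relative to the product of \<nu>: the weights \<phi> have moved into
    the measure, and the Vandermonde product has become P times the n-point determinant.\<close>
  define f where "f z = ennreal (C * P * Re (kernel_det K n z))" for z
  have f [measurable]: "f \<in> borel_measurable (PiM {..<n} (\<lambda>_. \<nu>))"
    unfolding f_def by measurable
  have sets: "sets (PiM {..<n} (\<lambda>_. \<nu>)) = sets (PiM {..<n} (\<lambda>_. lborel))"
    by (intro sets_PiM_cong) (auto simp: \<nu>_def)
  \<comment> \<open>The sign of C is not known yet, so the product is split at the factor formed by
    \<phi>, which is nonnegative.\<close>
  have eq: "ennreal (C * (\<Prod>k<n. \<Prod>j<k. (cmod (z j - z k))\<^sup>2) * (\<Prod>j<n. \<phi> (cmod (z j)))) =
      (\<Prod>j<n. ennreal (\<phi> (cmod (z j)))) * f z" for z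
    by (subst ennreal_mult'')
       (auto simp: f_def det prod_ennreal \<phi>_nonneg mult_ac intro!: prod_nonneg)
  have Zf: "distributed M (PiM {..<n} (\<lambda>_. \<nu>)) (first_vars n Z) f"
  proof -
    have "distr M (PiM {..<n} (\<lambda>_. \<nu>)) (first_vars n Z) =
        distr M (PiM {..<n} (\<lambda>_. lborel)) (first_vars n Z)"
      by (rule distr_cong[OF refl sets refl])
    moreover have "density (PiM {..<n} (\<lambda>_. \<nu>)) f =
        density (PiM {..<n} (\<lambda>_. lborel)) (\<lambda>z. (\<Prod>j<n. ennreal (\<phi> (cmod (z j)))) * f z)"
      unfolding PiM using f
      by (intro density_density_eq) (auto simp: measurable_cong_sets[OF sets refl])
    moreover have "first_vars n Z \<in> M \<rightarrow>\<^sub>M PiM {..<n} (\<lambda>_. \<nu>)"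
      unfolding measurable_cong_sets[OF refl sets] by (rule distributed_measurable[OF Z_density])
    ultimately show ?thesis
      using Z_density f eq by (simp add: distributed_def)
  qed
  interpret M: prob_space M by fact
  have "1 = emeasure M (first_vars n Z -` space (PiM {..<n} (\<lambda>_. \<nu>)) \<inter> space M)"
    using measurable_space[OF distributed_measurable[OF Zf]]
    by (subst Int_absorb1) (auto simp: M.emeasure_space_1)
  also have "\<dots> = (\<integral>\<^sup>+z. f z \<partial>PiM {..<n} (\<lambda>_. \<nu>))"
    by (subst distributed_emeasure[OF Zf]) (auto intro!: nn_integral_cong)
  also have "\<dots> = ennreal (C * P) * (\<integral>\<^sup>+z. ennreal (Re (kernel_det K n z)) \<partial>PiM {..<n} (\<lambda>_. \<nu>))"
  proof -
    have "f = (\<lambda>z. ennreal (C * P) * ennreal (Re (kernel_det K n z)))"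
      using kernel_det_nonneg[of n] by (simp add: fun_eq_iff f_def ennreal_mult'' complex_nonneg_Reals_iff)
    then show ?thesis
      by (simp add: nn_integral_cmult)
  qed
  also have "\<dots> = ennreal (C * P * fact n)"
    by (simp add: nn_integral_kernel_det_PiM ennreal_mult'')
  \<comment> \<open>\<open>ennreal\<close> sends negative reals to 0, so the value 1 can only come
    from the real number 1; this also settles the sign of C.\<close>
  finally have CP: "C * P * fact n = 1"
    by (metis ennreal_eq_1)
  then have "inverse C = fact n * P"
    by (intro inverse_unique) (simp add: mult_ac)
  moreover have "f = (\<lambda>z. ennreal (Re (kernel_det K n z) / fact n))"
  proof -
    have "C * P = 1 / fact n"
      using CP by (simp add: field_simps)
    then show ?thesis
      by (simp add: f_def fun_eq_iff)
  qed
  ultimately show ?thesis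
    using determinantal_point_process Zf unfolding \<nu>_def K_def P_def by simp
qed

end
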